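(* Let $(A,(p_s)_{s\in S})$ be a weakly $\sigma^*$-compact-regular locally convex algebra with unit, satisfying property (P). Let $B$ be a locally convex algebra, and let $\phi:A\to B$ be a one-to-one algebra homomorphism such that $C=\overline{\operatorname{Im}\phi}$ (the closure of $\operatorname{Im}\phi$ in $B$) is a strongly semisimple Q-algebra. Then $\phi^{-1}:\operatorname{Im}\phi\to A$ is continuous (where $\operatorname{Im}\phi$ carries the topology induced by $B$).
   Context: A topological algebra is an (associative, not necessarily commutative) algebra over $\mathbb{C}$ which is also a Hausdorff topological vector space such that the multiplication is separately continuous. A locally convex algebra $(A,(p_s)_{s\in S})$ is a topological algebra whose topology is locally convex, determined by the family of seminorms $(p_s)_{s\in S}$. $M^*(A)$ denotes the set of all nonzero multiplicative linear functionals $A\to\mathbb{C}$, endowed with the weak-$*$ topology of pointwise convergence on $A$, and $M(A)$ the subset of the continuous ones. $A$ is weakly $\sigma^*$-compact-regular if for every compact subset $K\subset M^*(A)$ with $K\neq M^*(A)$, there exists a nonzero $x\in A$ such that $f(x)=0$ for all $f\in K$. A topological algebra $C$ is strongly semisimple if for every $x\in C$, $x\ne0$, there exists $f\in M(C)$ such that $f(x)\neq0$. $(A,(p_s)_{s\in S})$ satisfies property (P) if $M^*(A)\ne\emptyset$ and for all $x\in A$ and every $s\in S$ with $p_s(x)=1$, there exists $f_0\in M^*(A)$ such that $|f_0(x)|\ge 1$. A topological algebra is a Q-algebra if the set of its quasi-invertible elements is open, where $x$ is quasi-invertible if there is $y$ with $x+y+xy=0=x+y+yx$. *)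

theory Defs
  imports "HOL-Analysis.Analysis"
begin

locale complex_algebra = vector_space sc
  for sc :: "complex \<Rightarrow> 'a::ring \<Rightarrow> 'a" +
  assumes scale_mult_left: "sc c x * y = sc c (x * y)"
    and scale_mult_right: "x * sc c y = sc c (x * y)"

text \<open>Joint continuity of addition and the Hausdorff property are provided by the type classes.\<close>

locale topological_algebra = complex_algebra sc
  for sc :: "complex \<Rightarrow> 'a::{ring, topological_ab_group_add, t2_space} \<Rightarrow> 'a" +
  assumes continuous_scale: "continuous_on UNIV (\<lambda>z. sc (fst z) (snd z))"
    and continuous_mult_left: "continuous_on UNIV (\<lambda>y::'a. x * y)"
    and continuous_mult_right: "continuous_on UNIV (\<lambda>y::'a. y * x)"

definition is_seminorm :: "(complex \<Rightarrow> 'a::ab_group_add \<Rightarrow> 'a) \<Rightarrow> ('a \<Rightarrow> real) \<Rightarrow> bool" where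
  "is_seminorm sc p \<longleftrightarrow>
     (\<forall>x. 0 \<le> p x) \<and> (\<forall>x y. p (x + y) \<le> p x + p y) \<and> (\<forall>c x. p (sc c x) = cmod c * p x)"

text \<open>The family of seminorms need not be directed: basic neighbourhoods are finite intersections
  of seminorm balls.\<close>

locale locally_convex_algebra = topological_algebra sc
  for sc :: "complex \<Rightarrow> 'a::{ring, topological_ab_group_add, t2_space} \<Rightarrow> 'a"
    and S :: "'s set"
    and p :: "'s \<Rightarrow> 'a \<Rightarrow> real" +
  assumes seminorm: "s \<in> S \<Longrightarrow> is_seminorm sc (p s)"
    and open_iff_seminorms:
      "open U \<longleftrightarrow> (\<forall>x\<in>U. \<exists>F e. finite F \<and> F \<subseteq> S \<and> 0 < e \<and> {y. \<forall>s\<in>F. p s (y - x) < e} \<subseteq> U)"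

definition algebra_hom ::
  "(complex \<Rightarrow> 'a::ring \<Rightarrow> 'a) \<Rightarrow> (complex \<Rightarrow> 'b::ring \<Rightarrow> 'b) \<Rightarrow> ('a \<Rightarrow> 'b) \<Rightarrow> bool" where
  "algebra_hom sA sB \<phi> \<longleftrightarrow> Vector_Spaces.linear sA sB \<phi> \<and> (\<forall>x y. \<phi> (x * y) = \<phi> x * \<phi> y)"

text \<open>The following notions are relative to a subalgebra \<open>V\<close> of the ambient algebra, carrying the
  induced topology; \<open>V = UNIV\<close> gives the algebra itself. Functionals on \<open>V\<close> are represented as
  extensional functions, which is no restriction when \<open>V = UNIV\<close>. The first two
  sets are \<open>M\<^sup>*(V)\<close> and \<open>M(V)\<close>.\<close>

definition mult_functionals :: "(complex \<Rightarrow> 'a::ring \<Rightarrow> 'a) \<Rightarrow> 'a set \<Rightarrow> ('a \<Rightarrow> complex) set" where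
  "mult_functionals sc V =
     {f \<in> extensional V.
        (\<forall>x\<in>V. \<forall>y\<in>V. f (x + y) = f x + f y) \<and>
        (\<forall>c. \<forall>x\<in>V. f (sc c x) = c * f x) \<and>
        (\<forall>x\<in>V. \<forall>y\<in>V. f (x * y) = f x * f y) \<and>
        (\<exists>x\<in>V. f x \<noteq> 0)}"

definition cont_mult_functionals ::
  "(complex \<Rightarrow> 'a::{ring, topological_space} \<Rightarrow> 'a) \<Rightarrow> 'a set \<Rightarrow> ('a \<Rightarrow> complex) set" where
  "cont_mult_functionals sc V = {f \<in> mult_functionals sc V. continuous_on V f}"

definition strongly_semisimple ::
  "(complex \<Rightarrow> 'a::{ring, topological_space} \<Rightarrow> 'a) \<Rightarrow> 'a set \<Rightarrow> bool" where
  "strongly_semisimple sc V \<longleftrightarrow>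
     (\<forall>x\<in>V. x \<noteq> 0 \<longrightarrow> (\<exists>f\<in>cont_mult_functionals sc V. f x \<noteq> 0))"

definition quasi_invertibles :: "'a::ring set \<Rightarrow> 'a set" where
  "quasi_invertibles V = {x \<in> V. \<exists>y\<in>V. x + y + x * y = 0 \<and> x + y + y * x = 0}"

definition Q_algebra :: "'a::{ring, topological_space} set \<Rightarrow> bool" where
  "Q_algebra V \<longleftrightarrow> openin (top_of_set V) (quasi_invertibles V)"

text \<open>The library topology on \<^typ>\<open>'a \<Rightarrow> complex\<close> is the product topology, i.e. that of pointwise
  convergence; it induces the weak-* topology on \<open>M\<^sup>*\<close>.\<close>

definition weakly_sigma_compact_regular :: "(complex \<Rightarrow> 'a::ring \<Rightarrow> 'a) \<Rightarrow> bool" where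
  "weakly_sigma_compact_regular sc \<longleftrightarrow>
     (\<forall>K. compact K \<and> K \<subseteq> mult_functionals sc UNIV \<and> K \<noteq> mult_functionals sc UNIV \<longrightarrow>
        (\<exists>x. x \<noteq> 0 \<and> (\<forall>f\<in>K. f x = 0)))"

definition property_P ::
  "(complex \<Rightarrow> 'a::ring \<Rightarrow> 'a) \<Rightarrow> 's set \<Rightarrow> ('s \<Rightarrow> 'a \<Rightarrow> real) \<Rightarrow> bool" where
  "property_P sc S p \<longleftrightarrow>
     mult_functionals sc UNIV \<noteq> {} \<and>
     (\<forall>x. \<forall>s\<in>S. p s x = 1 \<longrightarrow> (\<exists>f\<in>mult_functionals sc UNIV. 1 \<le> cmod (f x)))"

end

theory Submission
  imports Defs
begin

text \<open>
  Every multiplicative functional on the closure \<open>C\<close> of \<open>range \<phi>\<close> is dominated by one and the same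
  continuous seminorm: if \<open>f x \<noteq> 0\<close> then \<open>- x / f x\<close> is not quasi-invertible, so it cannot lie in
  a seminorm ball consisting of quasi-invertible elements. By Tychonoff the multiplicative
  functionals on \<open>C\<close> form a compact set, the unit of \<open>A\<close> keeping them away from \<open>0\<close>. Their
  restrictions to \<open>A\<close> are a compact set of multiplicative functionals; were it proper, regularity
  would yield a nonzero element killed by all of them, against strong semisimplicity. So every
  multiplicative functional on \<open>A\<close> comes from \<open>C\<close>, and property (P) bounds the seminorms of \<open>A\<close>
  by the common seminorm on \<open>C\<close>.
\<close>

section \<open>Passing algebraic structure to closures\<close>

lemma continuous_on_maps_closure:
  assumes "continuous_on UNIV f" "\<And>x. x \<in> X \<Longrightarrow> f x \<in> closure X" "x \<in> closure X"
  shows "f x \<in> closure X"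
proof -
  have "f ` closure X \<subseteq> closure X"
    using assms(2)
    by (intro image_closure_subset continuous_on_subset[OF assms(1)] closed_closure image_subsetI) simp_all
  then show ?thesis
    using assms(3) by blast
qed

lemma (in topological_algebra) subspace_closure:
  assumes "subspace X"
  shows "subspace (closure X)"
proof (rule subspaceI)
  show "0 \<in> closure X"
    using subspace_0[OF assms] closure_subset by blast
next
  fix x y assume xy: "x \<in> closure X" "y \<in> closure X"
  \<comment> \<open>The closure is reached one variable at a time: first the second summand, with
    the first still in \<open>X\<close>. The second pass works because
    \<open>continuous_on_maps_closure\<close> only asks \<open>X\<close> to be mapped into
    \<open>closure X\<close>.\<close>
  have right: "a + b \<in> closure X" if a: "a \<in> X" and b: "b \<in> closure X" for a b
  proof (rule continuous_on_maps_closure[OF _ _ b])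
    show "continuous_on UNIV (\<lambda>b. a + b)"
      by (intro continuous_intros)
    show "a + b \<in> closure X" if "b \<in> X" for b
      using subspace_add[OF assms a that] closure_subset by blast
  qed
  show "x + y \<in> closure X"
  proof (rule continuous_on_maps_closure[OF _ _ xy(1)])
    show "continuous_on UNIV (\<lambda>a. a + y)"
      by (intro continuous_intros)
  qed (rule right[OF _ xy(2)])
next
  fix c x assume x: "x \<in> closure X"
  show "sc c x \<in> closure X"
  proof (rule continuous_on_maps_closure[OF _ _ x])
    have "continuous_on UNIV (\<lambda>x. (c, x))"
      by (intro continuous_intros)
    then show "continuous_on UNIV (sc c)"
      using continuous_on_compose2[OF continuous_scale] by fastforce
    show "sc c x \<in> closure X" if "x \<in> X" for x
      using subspace_scale[OF assms that] closure_subset by blast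
  qed
qed

text \<open>In a Hausdorff space the equalizer of two continuous maps is closed. Since
  \<open>e\<close> is fixed, separate continuity of the product is enough.\<close>

lemma (in topological_algebra) left_unit_closure:
  fixes X :: "'a set"
  assumes "\<And>x. x \<in> X \<Longrightarrow> e * x = x" "x \<in> closure X"
  shows "e * x = x"
proof -
  have "closed {x. e * x = x}"
    by (intro closed_Collect_eq continuous_mult_left continuous_on_id)
  then show ?thesis
    using closure_minimal[of X "{x. e * x = x}"] assms by blast
qed

lemma mult_functionalsD:
  assumes "f \<in> mult_functionals sc V"
  shows mult_functionals_add: "\<And>x y. x \<in> V \<Longrightarrow> y \<in> V \<Longrightarrow> f (x + y) = f x + f y"
    and mult_functionals_scale: "\<And>c x. x \<in> V \<Longrightarrow> f (sc c x) = c * f x"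
    and mult_functionals_mult: "\<And>x y. x \<in> V \<Longrightarrow> y \<in> V \<Longrightarrow> f (x * y) = f x * f y"
    and mult_functionals_nonzero: "\<exists>x\<in>V. f x \<noteq> 0"
  using assms by (auto simp: mult_functionals_def)

text \<open>Cancel \<open>f x\<close> in \<open>f x = f e * f x\<close> at a point where
  \<open>f\<close> does not vanish.\<close>

lemma mult_functionals_unit:
  assumes "f \<in> mult_functionals sc V" "e \<in> V" "\<And>x. x \<in> V \<Longrightarrow> e * x = x"
  shows "f e = 1"
proof -
  obtain x where "x \<in> V" "f x \<noteq> 0"
    using mult_functionals_nonzero[OF assms(1)] by blast
  then show ?thesis
    using mult_functionals_mult[OF assms(1,2), of x] assms(3) by simp
qed

lemma seminormD:
  assumes "is_seminorm sc r"
  shows seminorm_nonneg: "0 \<le> r x"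
    and seminorm_triangle: "r (x + y) \<le> r x + r y"
    and seminorm_scale: "r (sc c x) = cmod c * r x"
  using assms by (auto simp: is_seminorm_def)

section \<open>Seminorm balls and bounds by seminorms\<close>

context locally_convex_algebra
begin

lemma seminorm_zero: "s \<in> S \<Longrightarrow> p s 0 = 0"
  using seminorm_scale[OF seminorm, of s 0 0] scale_zero_left[of 0] by simp

lemma seminorm_minus_commute: "s \<in> S \<Longrightarrow> p s (x - y) = p s (y - x)"
  using seminorm_scale[OF seminorm, of s "-1" "x - y"] by (simp add: scale_minus_left)

lemma seminorm_diff_triangle: "s \<in> S \<Longrightarrow> p s (x - z) \<le> p s (x - y) + p s (y - z)"
  using seminorm_triangle[OF seminorm, of s "x - y" "y - z"] by simp

lemma open_contains_seminorm_ball: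
  assumes "open U" "x \<in> U"
  obtains F e where "finite F" "F \<subseteq> S" "0 < e" "{y. \<forall>s\<in>F. p s (y - x) < e} \<subseteq> U"
  using bspec[OF iffD1[OF open_iff_seminorms assms(1)] assms(2)]
  by (elim exE conjE) (rule that)

lemma open_seminorm_ball:
  assumes s: "s \<in> S"
  shows "open {y. p s (y - x) < e}"
  unfolding open_iff_seminorms
proof
  fix y assume y: "y \<in> {y. p s (y - x) < e}"
  have "{z. p s (z - y) < e - p s (y - x)} \<subseteq> {z. p s (z - x) < e}"
  proof safe
    fix z assume "p s (z - y) < e - p s (y - x)"
    then show "p s (z - x) < e"
      using seminorm_diff_triangle[OF s, of z x y] by linarith
  qed
  with y s show "\<exists>F d. finite F \<and> F \<subseteq> S \<and> 0 < d \<and> {z. \<forall>s\<in>F. p s (z - y) < d} \<subseteq> {y. p s (y - x) < e}"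
    by (intro exI[of _ "{s}"] exI[of _ "e - p s (y - x)"]) auto
qed

lemma continuous_on_seminorm:
  assumes s: "s \<in> S"
  shows "continuous_on UNIV (p s)"
proof -
  have "(p s \<longlongrightarrow> p s x) (nhds x)" for x
  proof (rule tendstoI)
    fix e :: real assume "0 < e"
    then have "eventually (\<lambda>y. p s (y - x) < e) (nhds x)"
      unfolding eventually_nhds using open_seminorm_ball[OF s] seminorm_zero[OF s]
      by (intro exI[of _ "{y. p s (y - x) < e}"]) simp
    then show "eventually (\<lambda>y. dist (p s y) (p s x) < e) (nhds x)"
    proof eventually_elim
      case (elim y)
      then show ?case
        \<comment> \<open>Reverse triangle inequality: two triangle inequalities with one endpoint
          \<open>0\<close>.\<close>
        using seminorm_diff_triangle[OF s, of y 0 x] seminorm_diff_triangle[OF s, of x 0 y]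
          seminorm_minus_commute[OF s, of x y] by (auto simp: dist_real_def)
    qed
  qed
  then show ?thesis
    unfolding continuous_on_def at_within_def by (blast intro: tendsto_mono[OF inf_le1])
qed

text \<open>Since \<open>0\<close> is quasi-invertible, openness gives a ball about \<open>0\<close>
  in \<open>V\<close> of quasi-invertible elements; its data \<open>F\<close> and \<open>e\<close>
  give the bound, so it is uniform in \<open>f\<close> and needs no continuity of \<open>f\<close>.
  The sum over \<open>F\<close> dominates each of its seminorms, which replaces directedness of the
  family.\<close>

lemma Q_algebra_functionals_bound:
  assumes V: "subspace V" and Q: "Q_algebra V"
  obtains F e where "finite F" "F \<subseteq> S" "0 < e"
    "\<And>f x. f \<in> mult_functionals sc V \<Longrightarrow> x \<in> V \<Longrightarrow> cmod (f x) * e \<le> (\<Sum>s\<in>F. p s x)"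
proof -
  obtain U where U: "open U" "quasi_invertibles V = V \<inter> U"
    using Q by (auto simp: Q_algebra_def openin_open)
  have "0 \<in> quasi_invertibles V"
    using subspace_0[OF V] by (force simp: quasi_invertibles_def)
  then have "0 \<in> U"
    using U(2) by simp
  then obtain F e where F: "finite F" "F \<subseteq> S" "0 < e" and sub: "{y. \<forall>s\<in>F. p s (y - 0) < e} \<subseteq> U"
    by (rule open_contains_seminorm_ball[OF U(1)])
  have "cmod (f x) * e \<le> (\<Sum>s\<in>F. p s x)" if f: "f \<in> mult_functionals sc V" and x: "x \<in> V" for f x
  proof (rule ccontr)
    assume "\<not> ?thesis"
    then have less: "(\<Sum>s\<in>F. p s x) < cmod (f x) * e" by simp
    have nonneg: "0 \<le> p s x" if "s \<in> F" for s
      using that F(2) seminorm_nonneg[OF seminorm] by blast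
    have fx: "f x \<noteq> 0"
      using less sum_nonneg[of F "\<lambda>s. p s x"] nonneg by auto
    \<comment> \<open>The scaling makes \<open>f z = -1\<close>, a value no quasi-invertible element
      can take: applying \<open>f\<close> to \<open>z + y + z * y = 0\<close> would give
      \<open>-1 + f y - f y = 0\<close>.\<close>
    define z where "z = sc (- 1 / f x) x"
    have zV: "z \<in> V"
      unfolding z_def using subspace_scale[OF V x] .
    have fz: "f z = -1"
      unfolding z_def using mult_functionals_scale[OF f x, of "- 1 / f x"] fx
      by (simp del: scale_minus_left)
    have "p s z < e" if s: "s \<in> F" for s
    proof -
      have "p s x < cmod (f x) * e"
        using member_le_sum[OF s, of "\<lambda>s. p s x"] nonneg F(1) less by fastforce
      moreover have "p s z = p s x / cmod (f x)"
        unfolding z_def using seminorm_scale[OF seminorm, of s "- 1 / f x" x] s F(2)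
        by (auto simp: norm_divide)
      ultimately show ?thesis
        using fx by (simp add: pos_divide_less_eq mult.commute)
    qed
    then have "z \<in> quasi_invertibles V"
      using sub zV U(2) by auto
    then obtain y where y: "y \<in> V" "z + y + z * y = 0"
      by (auto simp: quasi_invertibles_def)
    have "z * y = sc (-1) (z + y)"
      using minus_unique[OF y(2)] by simp
    then have "f z * f y = - 1 * f (z + y)"
      using mult_functionals_mult[OF f zV y(1)]
        mult_functionals_scale[OF f subspace_add[OF V zV y(1)], of "-1"] by metis
    then have "f z * f y = - (f z + f y)"
      using mult_functionals_add[OF f zV y(1)] by simp
    then show False
      using fz by simp
  qed
  with F show thesis
    by (rule that)
qed

end

section \<open>Compactness of the space of multiplicative functionals\<close>

lemma compact_pointwise_bounded:
  fixes M :: "('a \<Rightarrow> 'c::euclidean_space) set"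
  assumes "closed M" "\<And>x. bounded ((\<lambda>f. f x) ` M)"
  shows "compact M"
proof -
  \<comment> \<open>Each factor is closed and bounded in a Euclidean space, so Tychonoff applies;
    \<open>M\<close> is a closed subset of the product.\<close>
  define P where "P = Pi\<^sub>E UNIV (\<lambda>x. closure ((\<lambda>f. f x) ` M))"
  have "compact P"
    using assms(2) compactin_PiE[of "\<lambda>_. euclidean" UNIV "\<lambda>x. closure ((\<lambda>f. f x) ` M)"]
    by (simp add: P_def euclidean_product_topology)
  moreover have "M \<subseteq> P"
    using closure_subset unfolding P_def by fastforce
  ultimately show ?thesis
    using compact_Int_closed[OF _ assms(1)] by (metis Int_absorb1)
qed

text \<open>Being nonzero is not a closed condition under pointwise limits, but with a left unit it
  becomes the closed condition \<open>f e = 1\<close>. All other conditions, extensionality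
  included, are equations between coordinates.\<close>

lemma closed_mult_functionals_unital:
  fixes sc :: "complex \<Rightarrow> 'a::ring \<Rightarrow> 'a"
  assumes "e \<in> V" "\<And>x. x \<in> V \<Longrightarrow> e * x = x"
  shows "closed (mult_functionals sc V)"
proof -
  have coord: "continuous_on UNIV (\<lambda>f::'a \<Rightarrow> complex. f x)" for x
    by (rule continuous_on_product_coordinates)
  have "mult_functionals sc V =
      {f. f e = 1} \<inter> (\<Inter>x\<in>-V. {f. f x = undefined}) \<inter>
      (\<Inter>x\<in>V. \<Inter>y\<in>V. {f. f (x + y) = f x + f y}) \<inter>
      (\<Inter>c. \<Inter>x\<in>V. {f. f (sc c x) = c * f x}) \<inter>
      (\<Inter>x\<in>V. \<Inter>y\<in>V. {f. f (x * y) = f x * f y})" (is "_ = ?R")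
  proof
    show "mult_functionals sc V \<subseteq> ?R"
      using mult_functionals_unit[OF _ assms] by (auto simp: mult_functionals_def extensional_def)
    show "?R \<subseteq> mult_functionals sc V"
    proof
      fix f assume f: "f \<in> ?R"
      then have "\<exists>x\<in>V. f x \<noteq> 0"
        using assms(1) by (intro bexI[of _ e]) auto
      with f show "f \<in> mult_functionals sc V"
        by (simp add: mult_functionals_def extensional_def)
    qed
  qed
  also have "closed \<dots>"
    by (intro closed_Int closed_INT ballI closed_Collect_eq coord continuous_intros)
  finally show ?thesis .
qed

lemma compact_mult_functionals:
  assumes "closed (mult_functionals sc V)"
    and "\<And>f x. f \<in> mult_functionals sc V \<Longrightarrow> x \<in> V \<Longrightarrow> cmod (f x) \<le> r x"
  shows "compact (mult_functionals sc V)"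
proof (rule compact_pointwise_bounded[OF assms(1)])
  fix x
  show "bounded ((\<lambda>f. f x) ` mult_functionals sc V)"
  proof (cases "x \<in> V")
    case True
    then show ?thesis
      using assms(2) by (auto intro!: boundedI)
  next
    \<comment> \<open>Off \<open>V\<close> every extensional functional has the value
      \<open>undefined\<close>, so this coordinate is bounded as well.\<close>
    case False
    then have "(\<lambda>f. f x) ` mult_functionals sc V \<subseteq> {undefined}"
      by (auto simp: mult_functionals_def extensional_def)
    then show ?thesis
      by (rule bounded_subset[rotated]) (simp add: finite_imp_bounded)
  qed
qed

section \<open>Pulling functionals back along a homomorphism\<close>

lemma continuous_on_precompose:
  "continuous_on X (\<lambda>f::'b \<Rightarrow> 'c::topological_space. f \<circ> g)"
proof (rule continuous_on_coordinatewise_then_product)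
  fix i
  show "continuous_on X (\<lambda>f. (f \<circ> g) i)"
    unfolding o_apply by (rule continuous_on_subset[OF continuous_on_product_coordinates]) simp
qed

text \<open>A functional that is nonzero on \<open>V\<close> may still vanish on
  \<open>range \<phi>\<close>, hence the assumption at \<open>x\<close>; the theorem takes
  \<open>x = 1\<close>.\<close>

lemma mult_functionals_precompose:
  fixes scA :: "complex \<Rightarrow> 'a::ring \<Rightarrow> 'a"
  assumes f: "f \<in> mult_functionals scB V" and \<phi>: "algebra_hom scA scB \<phi>"
    and V: "range \<phi> \<subseteq> V" and nz: "f (\<phi> x) \<noteq> 0"
  shows "f \<circ> \<phi> \<in> mult_functionals scA UNIV"
proof -
  interpret Vector_Spaces.linear scA scB \<phi>
    using \<phi> by (simp add: algebra_hom_def)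
  have "\<phi> x \<in> V" for x
    using V by blast
  then show ?thesis
    using f \<phi> nz by (auto simp: mult_functionals_def algebra_hom_def add scale)
qed

theorem theorem3p2:
  fixes scaleA :: "complex \<Rightarrow> 'a::{ring_1, topological_ab_group_add, t2_space} \<Rightarrow> 'a"
    and S :: "'s set" and p :: "'s \<Rightarrow> 'a \<Rightarrow> real"
    and scaleB :: "complex \<Rightarrow> 'b::{ring, topological_ab_group_add, t2_space} \<Rightarrow> 'b"
    and T :: "'t set" and q :: "'t \<Rightarrow> 'b \<Rightarrow> real"
    and \<phi> :: "'a \<Rightarrow> 'b"
  assumes "locally_convex_algebra scaleA S p"
    and "weakly_sigma_compact_regular scaleA"
    and "property_P scaleA S p"
    and "locally_convex_algebra scaleB T q"
    and "algebra_hom scaleA scaleB \<phi>"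
    and "inj \<phi>"
    and "strongly_semisimple scaleB (closure (range \<phi>))"
    and "Q_algebra (closure (range \<phi>))"
  shows "continuous_on (range \<phi>) (inv \<phi>)"
proof -
  interpret A: locally_convex_algebra scaleA S p by fact
  interpret B: locally_convex_algebra scaleB T q by fact
  interpret \<phi>: Vector_Spaces.linear scaleA scaleB \<phi>
    using assms(5) by (simp add: algebra_hom_def)
  define C where "C = closure (range \<phi>)"
  have subC: "range \<phi> \<subseteq> C"
    unfolding C_def by (rule closure_subset)
  have C: "B.subspace C"
    unfolding C_def by (intro B.subspace_closure \<phi>.subspace_image A.subspace_UNIV)
  \<comment> \<open>The unit of \<open>A\<close> yields a left unit of \<open>C\<close>, first on
    the range and then on its closure.\<close>
  have unit: "\<phi> 1 * x = x" if "x \<in> C" for x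
  proof (rule B.left_unit_closure)
    show "x \<in> closure (range \<phi>)"
      using that C_def by simp
    show "\<phi> 1 * y = y" if "y \<in> range \<phi>" for y
      using that assms(5) unfolding algebra_hom_def by (metis imageE mult_1)
  qed
  have unitC: "\<phi> 1 \<in> C"
    using subC by blast
  obtain F e where F: "finite F" "F \<subseteq> T" and e: "0 < e"
    and bound: "\<And>f x. f \<in> mult_functionals scaleB C \<Longrightarrow> x \<in> C \<Longrightarrow> cmod (f x) * e \<le> (\<Sum>t\<in>F. q t x)"
    using B.Q_algebra_functionals_bound[OF C] assms(8) unfolding C_def by metis
  define K where "K = (\<lambda>f. f \<circ> \<phi>) ` mult_functionals scaleB C"
  have "compact (mult_functionals scaleB C)"
    using bound e closed_mult_functionals_unital[OF unitC unit]
    by (intro compact_mult_functionals[where r="\<lambda>x. (\<Sum>t\<in>F. q t x) / e"]) (auto simp: field_simps)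
  then have "compact K"
    unfolding K_def by (intro compact_continuous_image continuous_on_precompose)
  moreover have "K \<subseteq> mult_functionals scaleA UNIV"
    using mult_functionals_unit[OF _ unitC unit] mult_functionals_precompose[OF _ assms(5) subC, of _ 1]
    by (fastforce simp: K_def)
  \<comment> \<open>If \<open>K\<close> kills \<open>x\<close>, then every multiplicative functional
    on \<open>C\<close>, in particular every continuous one, kills \<open>\<phi> x\<close>, which is
    nonzero by injectivity.\<close>
  moreover have "\<not> (\<exists>x. x \<noteq> 0 \<and> (\<forall>f\<in>K. f x = 0))"
  proof safe
    fix x assume "x \<noteq> 0" "\<forall>f\<in>K. f x = 0"
    moreover have "\<phi> x \<noteq> 0"
      using \<open>x \<noteq> 0\<close> assms(6) \<phi>.zero by (metis injD)
    ultimately show False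
      using assms(7) subC unfolding strongly_semisimple_def K_def C_def cont_mult_functionals_def
      by fastforce
  qed
  ultimately have K: "K = mult_functionals scaleA UNIV"
    using assms(2)[unfolded weakly_sigma_compact_regular_def, THEN spec, of K] by metis

  have dominated: "p s x * e \<le> (\<Sum>t\<in>F. q t (\<phi> x))" if s: "s \<in> S" for s x
  proof (cases "p s x = 0")
    case True
    then show ?thesis
      using F(2) by (auto intro!: sum_nonneg seminorm_nonneg[OF B.seminorm])
  next
    case False
    then have pos: "0 < p s x"
      using seminorm_nonneg[OF A.seminorm[OF s], of x] by simp
    \<comment> \<open>Property (P) speaks only of elements of seminorm 1; rescaling turns it into
      \<open>p s x \<le> cmod (g x)\<close> for some functional \<open>g\<close> on
      \<open>A\<close>.\<close>
    define y where "y = scaleA (complex_of_real (1 / p s x)) x"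
    have "p s y = 1"
      unfolding y_def seminorm_scale[OF A.seminorm[OF s]] using pos by (simp add: norm_divide)
    then obtain g where g: "g \<in> mult_functionals scaleA UNIV" "1 \<le> cmod (g y)"
      using assms(3) s unfolding property_P_def by blast
    have "cmod (g y) = cmod (g x) / p s x"
      unfolding y_def using mult_functionals_scale[OF g(1)] pos by (simp add: norm_mult norm_divide)
    with g(2) pos have "p s x \<le> cmod (g x)"
      by (simp add: field_simps)
    \<comment> \<open>The equality for \<open>K\<close> extends \<open>g\<close>, about whose
      continuity nothing is known, to a functional on \<open>C\<close>, where the uniform bound
      applies.\<close>
    moreover obtain f where "f \<in> mult_functionals scaleB C" "g = f \<circ> \<phi>"
      using g(1) K unfolding K_def by blast
    then have "cmod (g x) * e \<le> (\<Sum>t\<in>F. q t (\<phi> x))"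
      using bound[of f "\<phi> x"] subC by auto
    ultimately show ?thesis
      using e by (meson mult_right_mono less_imp_le order_trans)
  qed

  show ?thesis
    unfolding continuous_on_topological
  proof (intro ballI allI impI)
    fix y0 U assume "y0 \<in> range \<phi>" and U: "open U" "inv \<phi> y0 \<in> U"
    then obtain x0 where x0: "y0 = \<phi> x0" "x0 \<in> U"
      using assms(6) by auto
    obtain G d where "finite G" and G: "G \<subseteq> S" and d: "0 < d" and ball: "{x. \<forall>s\<in>G. p s (x - x0) < d} \<subseteq> U"
      by (rule A.open_contains_seminorm_ball[OF U(1) x0(2)])
    \<comment> \<open>The radius \<open>d * e\<close> absorbs the constant \<open>e\<close> of
      \<open>dominated\<close>. As \<open>F\<close> does not depend on \<open>s\<close>, one
      neighbourhood serves all seminorms in \<open>G\<close>.\<close>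
    define W where "W = {y. (\<Sum>t\<in>F. q t (y - y0)) < d * e}"
    have "continuous_on UNIV (\<lambda>y. q t (y - y0))" if "t \<in> F" for t
      using that F(2) by (intro continuous_on_compose2[OF B.continuous_on_seminorm]) (auto intro: continuous_intros)
    then have "open W"
      unfolding W_def by (intro open_Collect_less continuous_on_sum continuous_on_const)
    moreover have "y0 \<in> W"
      using F(2) B.seminorm_zero d e by (auto simp: W_def subset_iff)
    moreover have "inv \<phi> (\<phi> x) \<in> U" if "\<phi> x \<in> W" for x
    proof -
      have "p s (x - x0) < d" if "s \<in> G" for s
      proof -
        have "p s (x - x0) * e < d * e"
          using dominated[of s "x - x0"] that G \<open>\<phi> x \<in> W\<close> by (auto simp: W_def x0 \<phi>.diff)
        then show ?thesis
          using e by simp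
      qed
      then show ?thesis
        using ball assms(6) by auto
    qed
    ultimately show "\<exists>W. open W \<and> y0 \<in> W \<and> (\<forall>y\<in>range \<phi>. y \<in> W \<longrightarrow> inv \<phi> y \<in> U)"
      by blast
  qed
qed

end
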